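(* There exist infinitely many triangular numbers $\delta$ with $\delta \equiv 3 \pmod{12}$ such that the equation $x - y = \delta$ has no solution with $x$ and $y$ both perfect numbers.
   Context: A positive integer $N$ is perfect if $\sigma(N) = 2N$, where $\sigma$ denotes the sum-of-divisors function. A triangular number is an integer of the form $b(b-1)/2$ with $b$ a positive integer. *)

theory Defs
  imports "HOL-Number_Theory.Number_Theory"
begin

definition sigma :: "nat \<Rightarrow> nat" where
  "sigma n = (\<Sum>d | d dvd n. d)"

definition perfect :: "nat \<Rightarrow> bool" where
  "perfect n \<longleftrightarrow> n > 0 \<and> sigma n = 2 * n"

(* The natural-number division and subtraction are exact: b * (b - 1) is even and b > 0. *)
definition triangular :: "nat \<Rightarrow> bool" where
  "triangular t \<longleftrightarrow> (\<exists>b>0. t = b * (b - 1) div 2)"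

end

theory Submission
  imports Defs "HOL-Computational_Algebra.Nth_Powers"
begin

text \<open>
  Take \<open>\<delta> = b (b - 1) / 2\<close> with \<open>2 b - 1 = 29\<^sup>n\<close> and \<open>n \<equiv> 3\<close> modulo 24, so that
  \<open>b \<equiv> 99\<close> modulo 144. As \<open>\<delta>\<close> is odd, exactly one of \<open>x\<close> and \<open>y\<close> is odd, and an odd perfect
  number has the form \<open>q m\<^sup>2\<close> with a prime \<open>q \<equiv> 1\<close> modulo 4.

  If \<open>y\<close> is even, then either \<open>y = 6\<close> and 3 divides \<open>x\<close> exactly once, or 4 divides \<open>y\<close> and
  \<open>x \<equiv> 3\<close> modulo 4; neither is possible.

  If \<open>x\<close> is even, it is triangular as well, and with \<open>M = 2\<^sup>p\<close> the difference factors as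
  \<open>y = A B\<close>, where \<open>A = M - b\<close> and \<open>B = (M + b - 1) / 2\<close>. Since \<open>2 B - A = 29\<^sup>n\<close>,
  \<open>gcd A B = 29\<^sup>i\<close>, and one of \<open>A / 29\<^sup>i\<close>, \<open>B / 29\<^sup>i\<close> is a square. Both \<open>A\<close> and \<open>B\<close> are 2
  modulo 3, so \<open>i\<close> is odd. As \<open>B \<equiv> 1\<close> and \<open>29\<^sup>i \<equiv> 5\<close> modulo 8, the square is \<open>A / 29\<^sup>i\<close>.
  But 29 divides \<open>2 M - 1\<close>, which forces \<open>p \<equiv> 3\<close> modulo 4, and then \<open>A / 29\<^sup>i \<equiv> 2\<close> modulo 5.
\<close>

section \<open>Multiplicativity of \<open>sigma\<close> and its values at prime powers\<close>

lemma sigma_mult_coprime: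
  assumes "coprime m n" "m > 0" "n > 0"
  shows "sigma (m * n) = sigma m * sigma n"
proof -
  \<comment> \<open>Coprimality makes the splitting of a divisor of \<open>m * n\<close> into
    \<open>a dvd m\<close> and \<open>b dvd n\<close> unique.\<close>
  have inj: "inj_on (\<lambda>(a, b). a * b) ({d. d dvd m} \<times> {d. d dvd n})"
  proof (rule inj_onI, clarsimp)
    fix a b c d
    assume *: "a dvd m" "b dvd n" "c dvd m" "d dvd n" "a * b = c * d"
    have "coprime a d" "coprime c b"
      using * assms(1) by (meson coprime_divisors)+
    then have "a dvd c" "c dvd a"
      using *(5) by (metis coprime_dvd_mult_left_iff dvd_triv_left)+
    then have "a = c" by (rule dvd_antisym)
    moreover have "a > 0" using *(1) assms(2) by (auto intro: Nat.gr0I)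
    ultimately show "a = c \<and> b = d" using *(5) by simp
  qed
  have im: "(\<lambda>(a, b). a * b) ` ({d. d dvd m} \<times> {d. d dvd n}) = {d. d dvd m * n}"
    by (force dest: division_decomp intro: mult_dvd_mono)
  have "sigma m * sigma n = (\<Sum>(a, b)\<in>{d. d dvd m} \<times> {d. d dvd n}. a * b)"
    unfolding sigma_def by (simp add: sum_product sum.cartesian_product)
  also have "\<dots> = sum id ((\<lambda>(a, b). a * b) ` ({d. d dvd m} \<times> {d. d dvd n}))"
    by (subst sum.reindex[OF inj]) (simp add: case_prod_unfold)
  finally show ?thesis by (simp add: im sigma_def)
qed

lemma sigma_prime_power:
  assumes "prime p"
  shows "sigma (p ^ e) = (\<Sum>i\<le>e. p ^ i)"
proof -
  have "{d. d dvd p ^ e} = (\<lambda>i. p ^ i) ` {..e}"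
    using divides_primepow_nat[OF assms] by auto
  moreover have "inj_on (\<lambda>i. p ^ i) {..e}"
    using prime_gt_1_nat[OF assms] by (auto intro!: inj_onI)
  ultimately show ?thesis by (simp add: sigma_def sum.reindex)
qed

text \<open>The divisor sum has \<open>e + 1\<close> terms, all odd.\<close>

lemma sigma_odd_prime_power_odd_iff:
  assumes "prime r" "odd r"
  shows "odd (sigma (r ^ e)) \<longleftrightarrow> even e"
  unfolding sigma_prime_power[OF assms(1)]
  by (induction e) (use assms(2) in auto)

text \<open>The terms pair off as
  \<open>r ^ (2 * j) + r ^ (2 * j + 1) = r ^ (2 * j) * Suc r\<close>.\<close>

lemma Suc_dvd_sigma_prime_power:
  assumes "prime r" "odd e"
  shows "Suc r dvd sigma (r ^ e)"
proof -
  obtain j where e: "e = 2 * j + 1" using assms(2) by (elim oddE)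
  have "Suc r dvd (\<Sum>i\<le>2 * j + 1. r ^ i)"
  proof (induction j)
    case (Suc j)
    have "(\<Sum>i\<le>2 * Suc j + 1. r ^ i) = (\<Sum>i\<le>2 * j + 1. r ^ i) + r ^ (2 * j + 2) * Suc r"
      by (simp add: algebra_simps)
    with Suc show ?case by (simp add: dvd_add del: sum.atMost_Suc mult_Suc_right)
  qed simp
  then show ?thesis unfolding e sigma_prime_power[OF assms(1)] .
qed

section \<open>Euler's form of odd numbers from the residue of \<open>sigma\<close>\<close>

lemma odd_prime_power_decomposition:
  fixes n :: nat
  assumes "odd n" "n \<noteq> 1"
  obtains r e k where "prime r" "odd r" "odd k" "k < n" "n = r ^ e * k"
    "sigma n = sigma (r ^ e) * sigma k"
proof -
  obtain r where r: "prime r" "r dvd n" using assms(2) prime_factor_nat by blast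
  have n: "n > 0" using assms(1) by (auto intro: Nat.gr0I)
  define e where "e = multiplicity r n"
  obtain k where k: "n = r ^ e * k" "\<not> r dvd k"
    unfolding e_def
    by (rule multiplicity_decompose'[of n r]) (use r n in auto)
  have e: "e > 0" using k r by (cases e) auto
  have r1: "r > 1" using r(1) by (rule prime_gt_1_nat)
  have k0: "k > 0" using n k by (auto intro: Nat.gr0I)
  have "odd r" using r assms(1) by (metis dvd_trans)
  moreover have "odd k" using k assms(1) by auto
  moreover have "r ^ e > 1" using one_less_power[OF r1 e] .
  with k0 have "k < n" by (simp add: k(1))
  moreover have "coprime (r ^ e) k"
    using r k by (simp add: prime_imp_coprime)
  then have "sigma n = sigma (r ^ e) * sigma k"
    unfolding k(1) by (rule sigma_mult_coprime) (use r1 k0 in auto)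
  ultimately show ?thesis using that r k by blast
qed

text \<open>Every prime-power factor has odd \<open>sigma\<close>, hence an even exponent.\<close>

lemma square_if_odd_sigma:
  assumes "odd n" "odd (sigma n)"
  shows "\<exists>m. n = m\<^sup>2"
  using assms
proof (induction n rule: less_induct)
  case (less n)
  show ?case
  proof (cases "n = 1")
    case True
    then show ?thesis by (intro exI[of _ 1]) simp
  next
    case False
    obtain r e k where *: "prime r" "odd r" "odd k" "k < n" "n = r ^ e * k"
      "sigma n = sigma (r ^ e) * sigma k"
      using odd_prime_power_decomposition[OF less.prems(1) False] by metis
    with less.prems have "odd (sigma (r ^ e))" "odd (sigma k)" by auto
    then obtain m j where "k = m\<^sup>2" "e = 2 * j"
      using less.IH[of k] * sigma_odd_prime_power_odd_iff by (metis evenE)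
    with * show ?thesis
      by (intro exI[of _ "r ^ j * m"]) (simp add: power_mult_distrib power_mult[symmetric] mult.commute)
  qed
qed

text \<open>Just one prime power has even \<open>sigma\<close>, so only its exponent is odd. Its
  prime \<open>q\<close> is not 3 modulo 4, since \<open>Suc q\<close> divides
  \<open>sigma n\<close> and would contribute a factor 4.\<close>

lemma odd_sigma_2_mod_4:
  assumes "odd n" "sigma n mod 4 = 2"
  shows "\<exists>q m. prime q \<and> q mod 4 = 1 \<and> n = q * m\<^sup>2"
  using assms
proof (induction n rule: less_induct)
  case (less n)
  have "n \<noteq> 1" using less.prems by (auto simp: sigma_def)
  then obtain r e k where *: "prime r" "odd r" "odd k" "k < n" "n = r ^ e * k"
    "sigma n = sigma (r ^ e) * sigma k"
    using odd_prime_power_decomposition[OF less.prems(1)] by metis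
  show ?case
  proof (cases "even e")
    case True
    then obtain j where j: "e = 2 * j" by (elim evenE)
    have "odd (sigma (r ^ e))" using True * sigma_odd_prime_power_odd_iff by blast
    then have "sigma k mod 4 = 2"
    proof -
      obtain c where c: "sigma (r ^ e) = 2 * c + 1" using \<open>odd (sigma (r ^ e))\<close> by (elim oddE)
      have "even (sigma n)" using less.prems(2) by presburger
      then have "even (sigma k)" using * \<open>odd (sigma (r ^ e))\<close> by auto
      then obtain f where f: "sigma k = 2 * f" by (elim evenE)
      have "sigma n = 4 * (c * f) + sigma k" using * c f by (simp add: algebra_simps)
      then show ?thesis using less.prems(2) by simp
    qed
    then obtain q m where "prime q" "q mod 4 = 1" "k = q * m\<^sup>2" using less.IH * by blast
    with * j show ?thesis
      by (intro exI[of _ q] exI[of _ "r ^ j * m"] conjI)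
        (simp_all add: power_mult_distrib power_mult[symmetric] mult.commute mult.left_commute)
  next
    case False
    have r_dvd: "Suc r dvd sigma n" using Suc_dvd_sigma_prime_power[of r e] False * by simp
    have "r mod 4 \<noteq> 3"
    proof
      assume "r mod 4 = 3"
      then have "4 dvd Suc r" by presburger
      then have "4 dvd sigma n" using r_dvd by (rule dvd_trans)
      then show False using less.prems(2) by presburger
    qed
    then have r: "r mod 4 = 1" using *(2) by presburger
    have "even (sigma (r ^ e))" using False * sigma_odd_prime_power_odd_iff by blast
    have "odd (sigma k)"
    proof
      assume "even (sigma k)"
      then have "2 * 2 dvd sigma n" using * \<open>even (sigma (r ^ e))\<close> by (metis mult_dvd_mono)
      then show False using less.prems(2) by presburger
    qed
    then obtain m where "k = m\<^sup>2" using square_if_odd_sigma * by blast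
    moreover obtain j where "e = 2 * j + 1" using False by (elim oddE)
    ultimately show ?thesis using * r
      by (intro exI[of _ r] exI[of _ "r ^ j * m"])
        (simp add: power_mult_distrib power_mult[symmetric] mult.commute)
  qed
qed

section \<open>Shapes and residues of perfect numbers\<close>

lemma odd_perfect_form:
  assumes "perfect n" "odd n"
  obtains q m where "prime q" "q mod 4 = 1" "n = q * m\<^sup>2"
proof -
  have "sigma n mod 4 = 2"
    using assms unfolding perfect_def by presburger
  then show ?thesis using odd_sigma_2_mod_4[OF assms(2)] that by blast
qed

lemma odd_square_mod_4:
  fixes m :: nat
  assumes "odd m"
  shows "m\<^sup>2 mod 4 = 1"
proof -
  obtain j where "m = 2 * j + 1" using assms by (elim oddE)
  then have "m\<^sup>2 = 4 * (j\<^sup>2 + j) + 1" by (simp add: power2_eq_square algebra_simps)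
  then show ?thesis by presburger
qed

lemma odd_perfect_mod_4:
  assumes "perfect n" "odd n"
  shows "n mod 4 = 1"
proof -
  obtain q m where *: "q mod 4 = 1" "n = q * m\<^sup>2" using odd_perfect_form[OF assms] by metis
  then have "odd m" using assms(2) by auto
  then have "(q mod 4) * (m\<^sup>2 mod 4) mod 4 = 1" using * odd_square_mod_4 by simp
  then show ?thesis unfolding mod_mult_eq *(2) .
qed

text \<open>In \<open>q * m\<^sup>2\<close> the prime \<open>q\<close> is 1 modulo 4, so the factor
  3 comes from \<open>m\<close>.\<close>

lemma odd_perfect_3_dvd:
  assumes "perfect n" "odd n" "3 dvd n"
  shows "9 dvd n"
proof -
  obtain q m where *: "prime q" "q mod 4 = 1" "n = q * m\<^sup>2"
    using odd_perfect_form[OF assms(1,2)] by metis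
  have p3: "prime (3::nat)" by simp
  have "q \<noteq> 3" using * by auto
  then have "\<not> 3 dvd q" using * p3 primes_dvd_imp_eq by blast
  then have "3 dvd m"
    using assms(3) * p3 by (metis prime_dvd_mult_iff prime_dvd_power)
  then have "3\<^sup>2 dvd m\<^sup>2" by (rule dvd_power_same)
  then show ?thesis using * by simp
qed

text \<open>Euler's argument: for the odd part \<open>k = M * c\<close> it yields
  \<open>sigma k = k + c\<close>, which leaves \<open>k\<close> and \<open>c\<close> as the only
  divisors of \<open>k\<close>.\<close>

lemma even_perfect_form:
  assumes "perfect n" "even n"
  obtains p where "p \<ge> 2" "n = 2 ^ (p - 1) * (2 ^ p - 1)" "p = 2 \<or> odd p"
proof -
  have n: "n > 0" "sigma n = 2 * n" using assms(1) by (auto simp: perfect_def)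
  define e where "e = multiplicity 2 n"
  obtain k where k: "n = 2 ^ e * k" "\<not> 2 dvd k"
    unfolding e_def
    by (rule multiplicity_decompose'[of n 2]) (use n in auto)
  have e: "e > 0" using k assms(2) by (cases e) auto
  have k0: "k > 0" using k(2) by (auto intro: Nat.gr0I)
  define M :: nat where "M = 2 ^ (e + 1) - 1"
  have M: "2 ^ (e + 1) = M + 1" by (simp add: M_def)
  have "(\<Sum>i\<le>e. (2::nat) ^ i) + 1 = 2 ^ (e + 1)" by (induction e) auto
  then have s2: "sigma (2 ^ e) = M"
    using M sigma_prime_power[OF two_is_prime_nat, of e] by linarith
  have "coprime (2 ^ e) k" using k(2) by simp
  then have "sigma n = M * sigma k"
    using k k0 s2 by (simp add: sigma_mult_coprime)
  then have eq: "M * sigma k = (M + 1) * k"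
    using n(2) k(1) M by (simp add: algebra_simps)
  have "coprime M (M + 1)" by simp
  then have "M dvd k" using eq by (metis coprime_dvd_mult_right_iff dvd_triv_left)
  then obtain c where c: "k = M * c" by (elim dvdE)
  have "(2::nat) ^ 2 \<le> 2 ^ (e + 1)" using e by (intro power_increasing) auto
  then have M3: "M \<ge> 3" using M by simp
  have "M * sigma k = M * (k + c)" using eq c by (simp add: algebra_simps)
  then have sk: "sigma k = k + c" using M3 by simp
  have c0: "c > 0" using c k0 by (auto intro: Nat.gr0I)
  have ck: "c < k" using c c0 M3 by simp
  have fin: "finite {d. d dvd k}" using k0 by simp
  \<comment> \<open>A third divisor \<open>d\<close> would push \<open>sigma k\<close> above
    \<open>k + c\<close>.\<close>
  have divs: "d = k \<or> d = c" if "d dvd k" for d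
  proof (rule ccontr)
    assume "\<not> ?thesis"
    moreover have "d > 0" using that k0 by (auto intro: Nat.gr0I)
    moreover have "(\<Sum>d\<in>{d, k, c}. d) \<le> sigma k"
      unfolding sigma_def by (rule sum_mono2[OF fin]) (use that c in auto)
    ultimately show False using sk ck by simp
  qed
  from divs[of 1] have c1: "c = 1" using ck c0 by auto
  then have kM: "k = M" using c by simp
  have "e + 1 = 2 \<or> odd (e + 1)"
  proof (rule disjCI)
    assume "\<not> odd (e + 1)"
    then obtain j where j: "e + 1 = 2 * j" by blast
    \<comment> \<open>An even exponent makes 3 a divisor of \<open>k\<close>, whose only divisors
      are 1 and \<open>k\<close>.\<close>
    have "(4::nat) ^ j mod 3 = 1" by (subst power_mod[symmetric]) simp
    then have "(M + 1) mod 3 = 1" by (simp only: M[symmetric] j power_mult) simp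
    then have "3 dvd k" using kM by presburger
    then have "k = 3" using divs[of 3] c1 by auto
    then have "2 ^ (e + 1) = (2::nat) ^ 2" using kM M by simp
    then show "e + 1 = 2" by (subst (asm) power_inject_exp) auto
  qed
  then show ?thesis
    using that[of "e + 1"] e k(1) kM M_def by simp
qed

section \<open>Coprime cofactors in a prime times a square\<close>

lemma coprime_cofactor_square:
  fixes a b d q m :: nat
  assumes "prime q" "coprime a b" "a > 0" "b > 0" "d > 0" "(d * a) * (d * b) = q * m\<^sup>2"
  shows "is_nth_power 2 a \<or> is_nth_power 2 b"
proof -
  define h where "h = gcd d m"
  have "h > 0" using assms(5) by (simp add: h_def)
  obtain d' m' where dm: "d = d' * h" "m = m' * h" "coprime d' m'"
    using gcd_coprime_exists[of d m] assms(5) unfolding h_def by auto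
  \<comment> \<open>Cancelling \<open>h\<^sup>2\<close> leaves \<open>d'\<close> coprime to
    \<open>m'\<close>, so \<open>d'\<^sup>2\<close> divides the prime \<open>q\<close> and
    \<open>d' = 1\<close>. Then \<open>q\<close> divides one of \<open>a\<close> and
    \<open>b\<close>, and the other is a square.\<close>
  have "h\<^sup>2 * (d'\<^sup>2 * (a * b)) = h\<^sup>2 * (q * m'\<^sup>2)"
    using assms(6) unfolding dm by (simp add: power2_eq_square algebra_simps)
  then have eq: "d'\<^sup>2 * (a * b) = q * m'\<^sup>2" using \<open>h > 0\<close> by simp
  have "coprime (d'\<^sup>2) (m'\<^sup>2)" using dm(3) by simp
  then have dq: "d'\<^sup>2 dvd q" using eq by (metis coprime_dvd_mult_left_iff dvd_triv_left)
  have "d' = 1"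
  proof -
    have "d' dvd q" using dq by (simp add: power2_eq_square dvd_mult_left)
    then have "d' = 1 \<or> d' = q" using assms(1) prime_nat_iff by blast
    moreover have "\<not> q\<^sup>2 dvd q"
      using prime_gt_1_nat[OF assms(1)] by (auto simp: power2_eq_square dest!: dvd_imp_le)
    ultimately show ?thesis using dq by auto
  qed
  then have ab: "a * b = q * m'\<^sup>2" using eq by simp
  have *: "is_nth_power 2 y"
    if xy: "coprime x y" "x * y = q * m'\<^sup>2" "q dvd x" for x y
  proof -
    obtain z where z: "x = q * z" using xy(3) by (elim dvdE)
    then have "z * y = m'\<^sup>2" using xy(2) assms(1) by (auto simp: prime_gt_0_nat)
    moreover have "coprime z y" using xy(1) z by simp
    ultimately show ?thesis using is_nth_power_mult_coprime_nat_iff[of z y 2] by auto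
  qed
  have "q dvd a \<or> q dvd b" using ab assms(1) by (metis dvd_triv_left prime_dvd_mult_iff)
  then show ?thesis
    using *[of a b] *[of b a] ab assms(2) by (auto simp: ac_simps)
qed

section \<open>Residues of squares and powers\<close>

lemma square_mod_3_neq_2: "(u\<^sup>2 :: nat) mod 3 \<noteq> 2"
proof -
  have "u mod 3 \<in> {0, 1, 2}" by auto
  then show ?thesis by (subst power_mod[symmetric]) auto
qed

lemma square_mod_8: "(u\<^sup>2 :: nat) mod 8 \<in> {0, 1, 4}"
proof -
  have "u mod 8 \<in> {0, 1, 2, 3, 4, 5, 6, 7}" by auto
  then show ?thesis by (subst power_mod[symmetric]) auto
qed

lemma square_mod_5: "(u\<^sup>2 :: nat) mod 5 \<in> {0, 1, 4}"
proof -
  have "u mod 5 \<in> {0, 1, 2, 3, 4}" by auto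
  then show ?thesis by (subst power_mod[symmetric]) auto
qed

text \<open>The modulus is \<open>3 * 5 * 8\<close>, so one computation serves all three moduli;
  \<open>29\<^sup>2 = 7 * 120 + 1\<close>.\<close>

lemma power_29_mod_120: "(29::nat) ^ i mod 120 = (if even i then 1 else 29)"
proof (induction i)
  case (Suc i)
  have "(29::nat) ^ Suc i mod 120 = 29 * (29 ^ i mod 120) mod 120"
    by (simp add: mod_mult_right_eq)
  then show ?case by (simp add: Suc)
qed simp

text \<open>The listed residues form the subgroup of order 7 generated by 16.\<close>

lemma power_16_mod_29: "(16::nat) ^ l mod 29 \<in> {1, 7, 16, 20, 23, 24, 25}"
proof (induction l)
  case (Suc l)
  have "(16::nat) ^ Suc l mod 29 = 16 * (16 ^ l mod 29) mod 29"
    by (simp add: mod_mult_right_eq)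
  then show ?case using Suc by auto
qed simp

text \<open>For \<open>p = 4 * l + 1\<close> the power is \<open>4 * 16 ^ l\<close>, but the inverse
  of 4 modulo 29 is 22, which is not a power of 16.\<close>

lemma odd_exponent_4_dvd:
  fixes p :: nat
  assumes "odd p" "2 ^ (p + 1) mod 29 = (1::nat)"
  shows "p mod 4 = 3"
proof (rule ccontr)
  assume "p mod 4 \<noteq> 3"
  then have "p mod 4 = 1" using assms(1) by presburger
  then obtain l where "p = 4 * l + 1" by (metis mod_mult_div_eq add.commute)
  then have "(2::nat) ^ (p + 1) = 4 * 16 ^ l" by (simp add: power_mult)
  then have "4 * ((16::nat) ^ l mod 29) mod 29 = 1" using assms(2) by (simp add: mod_mult_right_eq)
  then show False using power_16_mod_29[of l] by auto
qed

section \<open>Impossibility of the difference\<close>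

lemma not_prime_times_square:
  fixes A B b k p q m n :: nat
  assumes b: "b = 144 * k + 99" and g: "2 * b - 1 = 29 ^ n" and "odd n"
    and p: "odd p" "p \<ge> 5"
    and A: "A + b = 2 ^ p" "A > 0" and B: "2 * B + 1 = 2 ^ p + b"
    and q: "prime q"
  shows "A * B \<noteq> q * m\<^sup>2"
proof
  assume eq: "A * B = q * m\<^sup>2"
  define d where "d = gcd A B"
  have BA: "2 * B = A + 29 ^ n" using A B g b by simp
  have d0: "d > 0" using A(2) by (simp add: d_def)
  obtain A' B' where A': "A = d * A'" and B': "B = d * B'" and cop: "coprime A' B'"
    using gcd_coprime_exists[of A B] d0 unfolding d_def by (auto simp: ac_simps)
  have pos: "A' > 0" "B' > 0" using A(2) BA A' B' by (auto intro: Nat.gr0I)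
  have "d dvd A + 29 ^ n" unfolding BA[symmetric] by (simp add: d_def)
  then have "d dvd 29 ^ n" by (simp add: d_def dvd_add_right_iff)
  moreover have "prime (29::nat)" by simp
  ultimately obtain i where i: "d = 29 ^ i" using divides_primepow_nat by blast
  have "is_nth_power 2 A' \<or> is_nth_power 2 B'"
    using coprime_cofactor_square[OF q cop pos d0, of m] eq A' B' by simp
  then obtain u where u: "A = d * u\<^sup>2 \<or> B = d * u\<^sup>2"
    using A' B' by (auto simp: is_nth_power_def)
  obtain j where j: "p = 2 * j + 1" using p(1) by (elim oddE)
  have "(4::nat) ^ j mod 3 = 1" by (subst power_mod[symmetric]) simp
  then obtain c where "(4::nat) ^ j = 3 * c + 1" by (metis mult_div_mod_eq)
  then have M3: "(2::nat) ^ p = 3 * (2 * c) + 2" by (simp add: j power_mult)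
  have "(2::nat) ^ 4 dvd 2 ^ p" using p by (intro le_imp_power_dvd) simp
  then obtain e where M16: "(2::nat) ^ p = 16 * e" by (auto elim: dvdE)
  \<comment> \<open>Here \<open>2 ^ p\<close> is 2 modulo 3 because \<open>p\<close> is odd, and 3
    divides \<open>b\<close>.\<close>
  have A3: "A mod 3 = 2"
  proof -
    have "A + 3 * (48 * k + 33) = 3 * (2 * c) + 2" using A(1) M3 b by simp
    then show ?thesis by presburger
  qed
  have B3: "B mod 3 = 2"
  proof -
    have "2 * B = 3 * (2 * c + 48 * k + 33) + 1" using B M3 b by simp
    then show ?thesis by presburger
  qed
  \<comment> \<open>Modulo 16, \<open>2 ^ p\<close> vanishes and \<open>b\<close> is 3.\<close>
  have "B = 8 * (e + 9 * k + 6) + 1" using B M16 b by simp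
  then have B8: "B mod 8 = 1" by presburger
  show False
  proof (cases "even i")
    case True
    then have "d mod 120 = 1" by (simp add: i power_29_mod_120)
    then have "d mod 3 = 1" using mod_mod_cancel[of 3 120 d] by simp
    then have "d * u\<^sup>2 mod 3 = u\<^sup>2 mod 3" by (metis mod_mult_left_eq mult_1)
    then show False using u A3 B3 square_mod_3_neq_2 by metis
  next
    case False
    then have d: "d mod 120 = 29" by (simp add: i power_29_mod_120)
    have "B \<noteq> d * u\<^sup>2"
    proof
      assume *: "B = d * u\<^sup>2"
      have "d mod 8 = 5" using d mod_mod_cancel[of 8 120 d] by simp
      then have "5 * (u\<^sup>2 mod 8) mod 8 = 1" using B8 * mod_mult_eq[of d 8 "u\<^sup>2"] by simp
      then show False using square_mod_8[of u] by auto
    qed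
    then have Au: "A = d * u\<^sup>2" using u by blast
    \<comment> \<open>This is \<open>2 * A + 2 * b = 2 ^ (p + 1)\<close>; as \<open>i\<close> is
      odd, 29 divides \<open>d\<close> and hence \<open>A\<close>.\<close>
    have M2: "2 * A + 29 ^ n + 1 = 2 ^ (p + 1)" using A(1) b unfolding g[symmetric] by simp
    have "29 dvd d" using False by (cases i) (auto simp: i)
    then have "29 dvd 2 * A" using Au by simp
    moreover have "(29::nat) dvd 29 ^ n" using \<open>odd n\<close> by (cases n) auto
    ultimately have "29 dvd 2 * A + 29 ^ n" by (rule dvd_add)
    then obtain c where "2 * A + 29 ^ n = 29 * c" by (elim dvdE)
    then have "2 ^ (p + 1) mod 29 = (1::nat)" unfolding M2[symmetric] by (simp only:) simp
    then have "p mod 4 = 3" by (rule odd_exponent_4_dvd[OF p(1)])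
    then have "4 dvd p + 1" by presburger
    then obtain l where l: "p + 1 = 4 * l" by (elim dvdE)
    have "(16::nat) ^ l mod 5 = 1" by (subst power_mod[symmetric]) simp
    then have M5: "(2::nat) ^ (p + 1) mod 5 = 1" by (simp only: l power_mult) simp
    have "29 ^ n mod 120 = (29::nat)" using \<open>odd n\<close> by (simp add: power_29_mod_120)
    then have "29 ^ n mod 5 = (4::nat)" using mod_mod_cancel[of 5 120 "29 ^ n :: nat"] by simp
    then obtain f where "29 ^ n = 5 * f + (4::nat)" by (metis mult_div_mod_eq)
    moreover obtain h where "2 ^ (p + 1) = 5 * h + (1::nat)" using M5 by (metis mult_div_mod_eq)
    ultimately have "2 * A + 5 * f + 4 = 5 * h" using M2 by linarith
    then have "A mod 5 = 3" by presburger
    moreover have "d mod 5 = 4" using d mod_mod_cancel[of 5 120 d] by simp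
    \<comment> \<open>This would make \<open>u\<^sup>2\<close> congruent to 2 modulo 5.\<close>
    ultimately have "4 * (u\<^sup>2 mod 5) mod 5 = 3"
      using Au mod_mult_eq[of d 5 "u\<^sup>2"] by simp
    then show False using square_mod_5[of u] by auto
  qed
qed

lemma no_perfect_difference:
  fixes b k n \<delta> x y :: nat
  assumes b: "b = 144 * k + 99" and g: "2 * b - 1 = 29 ^ n" and n: "odd n"
    and \<delta>: "2 * \<delta> = b * (b - 1)"
    and xy: "perfect x" "perfect y" "x = y + \<delta>"
  shows False
proof -
  have d: "\<delta> = (144 * k + 99) * (72 * k + 49)"
    using \<delta> unfolding b by (simp add: algebra_simps)
  have "\<delta> = 36 * (288 * k\<^sup>2 + 394 * k + 134) + 27"
    unfolding d by (simp add: power2_eq_square algebra_simps)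
  \<comment> \<open>This form shows at once that \<open>\<delta>\<close> is odd, 3 modulo 4 and
    divisible by 9.\<close>
  then obtain D where d36: "\<delta> = 36 * D + 27" by blast
  show False
  proof (cases "even x")
    case True
    then have "odd y" using xy(3) d36 by simp
    obtain p where p: "p \<ge> 2" "x = 2 ^ (p - 1) * (2 ^ p - 1)" "p = 2 \<or> odd p"
      using even_perfect_form[OF xy(1) True] by metis
    have y0: "y > 0" using xy(2) by (simp add: perfect_def)
    define M :: nat where "M = 2 ^ p"
    have "M = 2 * 2 ^ (p - 1)" using p(1) by (cases p) (auto simp: M_def)
    then have x: "2 * x = M * (M - 1)" by (simp add: p M_def)
    have Mb: "M > b"
    proof (rule ccontr)
      assume "\<not> M > b"
      then have "M * (M - 1) \<le> b * (b - 1)" by (intro mult_mono) auto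
      then show False using x \<delta> xy(3) y0 by linarith
    qed
    have p5: "p \<ge> 5"
    proof (rule ccontr)
      assume "\<not> p \<ge> 5"
      then have "M \<le> 2 ^ 4" unfolding M_def by (intro power_increasing) auto
      then show False using Mb b by simp
    qed
    then have "odd p" using p(3) by auto
    have evM: "even M" using p5 by (simp add: M_def)
    obtain A where A: "M = A + b" "A > 0" using Mb less_imp_add_positive by (metis add.commute)
    obtain B where B: "2 * B + 1 = M + b"
    proof -
      have "odd (M + b)" using evM b by simp
      then show ?thesis using that by (metis oddE)
    qed
    \<comment> \<open>\<open>M (M - 1) - b (b - 1) = (M - b) (M + b - 1)\<close>, computed in the
      integers to avoid truncated subtraction.\<close>
    have "2 * (A * B) = 2 * y"
    proof -
      have "int (2 * B) = int A + 2 * int b - 1" using A B by simp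
      then have "int (2 * (A * B)) = int A * (int A + 2 * int b - 1)" by simp
      moreover have "int (2 * x) = (int A + int b) * (int A + int b - 1)"
        unfolding x using A by (simp add: of_nat_diff)
      moreover have "int (2 * \<delta>) = int b * (int b - 1)"
        unfolding \<delta> using b by (simp add: of_nat_diff)
      moreover have "int (2 * x) = int (2 * y) + int (2 * \<delta>)" using xy(3) by simp
      ultimately have "int (2 * (A * B)) = int (2 * y)" by (simp add: algebra_simps)
      then show ?thesis by linarith
    qed
    then have y: "y = A * B" by simp
    obtain q m where "prime q" "y = q * m\<^sup>2"
      using odd_perfect_form[OF xy(2) \<open>odd y\<close>] by metis
    then show False
      using not_prime_times_square[OF b g n \<open>odd p\<close> p5 _ A(2), of B q m] A B y M_def by auto
  next
    case False
    then have "even y" using xy(3) d36 by simp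
    obtain p where p: "p \<ge> 2" "y = 2 ^ (p - 1) * (2 ^ p - 1)" "p = 2 \<or> odd p"
      using even_perfect_form[OF xy(2) \<open>even y\<close>] by metis
    show False
    proof (cases "p = 2")
      case True
      \<comment> \<open>Here \<open>y = 6\<close>, so \<open>x\<close> is 6 modulo 9.\<close>
      then have x: "x = 9 * (4 * D + 3) + 6" using p xy(3) d36 by simp
      then have "3 dvd x" by presburger
      then have "9 dvd x" using odd_perfect_3_dvd xy(1) False by blast
      then show False using x by presburger
    next
      assume "p \<noteq> 2"
      then have "(2::nat) ^ 2 dvd 2 ^ (p - 1)" using p(1) by (intro le_imp_power_dvd) auto
      then have "4 dvd y" using p(2) by simp
      then obtain z where "y = 4 * z" by (elim dvdE)
      then have "x = 4 * (z + 9 * D + 6) + 3" using xy(3) d36 by simp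
      then have "x mod 4 = 3" by presburger
      then show False using odd_perfect_mod_4[OF xy(1) False] by simp
    qed
  qed
qed

section \<open>The infinite family\<close>

lemma power_29_mod_288: "(29::nat) ^ (24 * t + 3) mod 288 = 197"
proof (induction t)
  case (Suc t)
  have "(29::nat) ^ (24 * Suc t + 3) = 29 ^ 24 * 29 ^ (24 * t + 3)"
    by (subst power_add[symmetric]) (simp add: algebra_simps)
  also have "\<dots> mod 288 = (29 ^ 24 mod 288) * (29 ^ (24 * t + 3) mod 288) mod 288"
    by (rule mod_mult_eq[symmetric])
  finally show ?case by (simp add: Suc)
qed simp

theorem theorem3p3:
  shows "infinite {\<delta> :: nat. triangular \<delta> \<and> [\<delta> = 3] (mod 12) \<and>
           \<not> (\<exists>x y :: nat. perfect x \<and> perfect y \<and> int x - int y = int \<delta>)}"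
    (is "infinite ?S")
proof (rule infinite_super)
  define f :: "nat \<Rightarrow> nat" where "f t = 29 ^ (24 * t + 3)" for t
  define b where "b t = 144 * (f t div 288) + 99" for t
  define \<delta> where "\<delta> t = b t * (b t - 1) div 2" for t
  \<comment> \<open>The constants match: \<open>2 * (144 * k + 99) - 1 = 288 * k + 197\<close>, and
    197 is the residue of \<open>29 ^ 3\<close>.\<close>
  have g: "2 * b t - 1 = f t" for t
    using power_29_mod_288[of t] mult_div_mod_eq[of 288 "f t"] by (simp add: b_def f_def)
  have d: "2 * \<delta> t = b t * (b t - 1)" for t
  proof -
    have "even (b t * (b t - 1))" by (simp add: b_def)
    then show ?thesis by (simp add: \<delta>_def)
  qed
  show "range \<delta> \<subseteq> ?S"
  proof clarsimp
    fix t
    define k where "k = f t div 288"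
    have bk: "b t = 144 * k + 99" by (simp add: b_def k_def)
    have "\<delta> t = 3 + 12 * (864 * k\<^sup>2 + 1182 * k + 404)"
      using d[of t] unfolding bk by (simp add: power2_eq_square algebra_simps)
    then have "[\<delta> t = 3] (mod 12)" unfolding cong_def by (simp only: mod_mult_self2)
    moreover have "triangular (\<delta> t)"
      unfolding triangular_def \<delta>_def by (intro exI[of _ "b t"]) (simp add: bk)
    moreover have "int x - int y \<noteq> int (\<delta> t)" if "perfect x" "perfect y" for x y
    proof
      assume "int x - int y = int (\<delta> t)"
      then have "x = y + \<delta> t" by linarith
      then show False
        using no_perfect_difference[OF bk g[unfolded f_def] _ d that] by simp
    qed
    ultimately show "triangular (\<delta> t) \<and> [\<delta> t = 3] (mod 12) \<and>
      (\<forall>x. perfect x \<longrightarrow> (\<forall>y. perfect y \<longrightarrow> int x - int y \<noteq> int (\<delta> t)))"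
      by blast
  qed
  have "inj \<delta>"
  proof (rule injI, rule ccontr)
    have lt: "\<delta> s < \<delta> t" if "s < t" for s t
    proof -
      have "f s < f t" unfolding f_def using that by (intro power_strict_increasing) auto
      then have "b s < b t" using g[of s] g[of t] by linarith
      moreover have "0 < b s" by (simp add: b_def)
      ultimately have "b s * (b s - 1) < b t * (b t - 1)" by (intro mult_strict_mono) auto
      then show ?thesis using d[of s] d[of t] by linarith
    qed
    fix s t assume "\<delta> s = \<delta> t" "s \<noteq> t"
    then show False using lt[of s t] lt[of t s] by linarith
  qed
  then show "infinite (range \<delta>)" by (simp add: finite_image_iff)
qed

end
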